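(* Let $(T,X)$ be an invertible minimal semiflow on a nonempty compact Hausdorff space $X$, with $T$ an almost right C-semigroup, and let $x_0\in X$. Then: (a) the reflection $(X,T)$ is minimal; (b) if $x_0$ is a distal l.a.p. point of $(T,X)$, then $x_0$ is an a.a. point of $(X,T)$.
   Context: $T$ is a topological semigroup with identity $e$. A semiflow $(T,X)$ is a jointly continuous map $T\times X\to X$, $(t,x)\mapsto tx$, with $ex=x$ and $t(sx)=(ts)x$. It is minimal if every orbit $Tx$ is dense in $X$, and invertible if each transition $x\mapsto tx$, $t\in T$, is a bijection of $X$. For invertible $(T,X)$, the reflection $(X,T)$ is the right-action semiflow $(x,t)\mapsto xt:=t^{-1}x$; it is minimal if $xT=\{xt: t\in T\}$ is dense in $X$ for every $x\in X$. $T$ is an almost right C-semigroup if $\{t\in T : \overline{T\setminus Tt}\text{ is compact in }T\}$ is dense in $T$. A set $A\subseteq T$ is syndetic if there is a compact $K\subseteq T$ with $Kt\cap A\neq\emptyset$ for all $t\in T$. A point $x$ is locally almost periodic (l.a.p.) for $(T,X)$ if for every neighborhood $U$ of $x$ there are a neighborhood $V$ of $x$ and a syndetic set $A\subseteq T$ with $AV\subseteq U$. Two points $x,y$ are proximal for $(T,X)$ if there is a net $\{t_n\}$ in $T$ with $\lim_n t_nx=\lim_n t_ny$. A point $x$ is distal for $(T,X)$ if it is proximal only to itself within $\overline{Tx}$. A point $x$ is an a.a. point of $(X,T)$ if for every net $\{t_n\}$ in $T$ and net $\{x_n'\}$ in $X$: $xt_n\to y$, $x_n'\to x'$ and $x_n't_n=y$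 for all $n$ imply $x=x'$. *)

theory Defs
  imports "HOL-Analysis.Analysis"
begin

text \<open>
  The topological semigroup with identity is a type of class \<^class>\<open>topological_monoid_mult\<close>
  (no separation axiom), the phase space is a second type, and \<open>act t x\<close> stands for \<open>tx\<close>.
\<close>

definition semiflow :: "('t::topological_monoid_mult \<Rightarrow> 'x::topological_space \<Rightarrow> 'x) \<Rightarrow> bool" where
  "semiflow act \<longleftrightarrow>
     continuous_on UNIV (\<lambda>(t, x). act t x) \<and>
     (\<forall>x. act 1 x = x) \<and>
     (\<forall>t s x. act t (act s x) = act (t * s) x)"

definition minimal_semiflow :: "('t \<Rightarrow> 'x::topological_space \<Rightarrow> 'x) \<Rightarrow> bool" where
  "minimal_semiflow act \<longleftrightarrow> (\<forall>x. closure (range (\<lambda>t. act t x)) = UNIV)"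

definition invertible_semiflow :: "('t \<Rightarrow> 'x \<Rightarrow> 'x) \<Rightarrow> bool" where
  "invertible_semiflow act \<longleftrightarrow> (\<forall>t. bij (act t))"

text \<open>
  Only meaningful for invertible \<open>act\<close>: then \<open>inv (act t)\<close> is the inverse of the transition
  of \<open>t\<close> (\<open>t\<close> itself need not be invertible in the semigroup).
\<close>

definition reflection :: "('t \<Rightarrow> 'x \<Rightarrow> 'x) \<Rightarrow> 'x \<Rightarrow> 't \<Rightarrow> 'x" where
  "reflection act x t = inv (act t) x"

definition minimal_right_semiflow :: "('x::topological_space \<Rightarrow> 't \<Rightarrow> 'x) \<Rightarrow> bool" where
  "minimal_right_semiflow ract \<longleftrightarrow> (\<forall>x. closure (range (\<lambda>t. ract x t)) = UNIV)"

definition almost_right_C_semigroup :: "'t::topological_monoid_mult itself \<Rightarrow> bool" where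
  "almost_right_C_semigroup _ \<longleftrightarrow>
     closure {t::'t. compact (closure (UNIV - range (\<lambda>s. s * t)))} = UNIV"

definition syndetic :: "'t::topological_monoid_mult set \<Rightarrow> bool" where
  "syndetic A \<longleftrightarrow> (\<exists>K. compact K \<and> (\<forall>t. (\<lambda>k. k * t) ` K \<inter> A \<noteq> {}))"

definition locally_almost_periodic ::
  "('t::topological_monoid_mult \<Rightarrow> 'x::topological_space \<Rightarrow> 'x) \<Rightarrow> 'x \<Rightarrow> bool" where
  "locally_almost_periodic act x \<longleftrightarrow>
     (\<forall>U. open U \<and> x \<in> U \<longrightarrow>
        (\<exists>V A. open V \<and> x \<in> V \<and> syndetic A \<and> (\<forall>a\<in>A. act a ` V \<subseteq> U)))"

text \<open>
  Nets are rendered by proper filters, which avoids a choice of index type.  In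
  \<open>proximal\<close>, \<open>F\<close> is the eventuality filter of a net \<open>(t\<^sub>n)\<close> in \<open>T\<close>; in
  \<open>aa_point\<close>, it is that of a net \<open>(t\<^sub>n, x\<^sub>n')\<close> in \<open>T \<times> X\<close>.  The lemmas at the end of this
  theory show that both definitions agree with the ones in terms of nets over
  directed sets.
\<close>

definition proximal :: "('t \<Rightarrow> 'x::topological_space \<Rightarrow> 'x) \<Rightarrow> 'x \<Rightarrow> 'x \<Rightarrow> bool" where
  "proximal act x y \<longleftrightarrow>
     (\<exists>(F::'t filter) z. F \<noteq> bot \<and> ((\<lambda>t. act t x) \<longlongrightarrow> z) F \<and> ((\<lambda>t. act t y) \<longlongrightarrow> z) F)"

definition distal_point :: "('t \<Rightarrow> 'x::topological_space \<Rightarrow> 'x) \<Rightarrow> 'x \<Rightarrow> bool" where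
  "distal_point act x \<longleftrightarrow> (\<forall>y \<in> closure (range (\<lambda>t. act t x)). proximal act x y \<longrightarrow> y = x)"

definition aa_point :: "('x::topological_space \<Rightarrow> 't \<Rightarrow> 'x) \<Rightarrow> 'x \<Rightarrow> bool" where
  "aa_point ract x \<longleftrightarrow>
     (\<forall>(F::('t \<times> 'x) filter) y x'.
        F \<noteq> bot \<and>
        ((\<lambda>(t, u). ract x t) \<longlongrightarrow> y) F \<and>
        ((\<lambda>(t, u). u) \<longlongrightarrow> x') F \<and>
        (\<forall>\<^sub>F (t, u) in F. ract u t = y)
        \<longrightarrow> x = x')"


definition directed_preorder :: "'i set \<Rightarrow> ('i \<Rightarrow> 'i \<Rightarrow> bool) \<Rightarrow> bool" where
  "directed_preorder D le \<longleftrightarrow>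
     D \<noteq> {} \<and> (\<forall>a\<in>D. le a a) \<and>
     (\<forall>a\<in>D. \<forall>b\<in>D. \<forall>c\<in>D. le a b \<and> le b c \<longrightarrow> le a c) \<and>
     (\<forall>a\<in>D. \<forall>b\<in>D. \<exists>c\<in>D. le a c \<and> le b c)"

definition net_tendsto ::
  "'i set \<Rightarrow> ('i \<Rightarrow> 'i \<Rightarrow> bool) \<Rightarrow> ('i \<Rightarrow> 'x::topological_space) \<Rightarrow> 'x \<Rightarrow> bool" where
  "net_tendsto D le f l \<longleftrightarrow>
     (\<forall>U. open U \<and> l \<in> U \<longrightarrow> (\<exists>d\<in>D. \<forall>n\<in>D. le d n \<longrightarrow> f n \<in> U))"

lemma net_filter:
  assumes "directed_preorder D le"
  obtains F where "F \<noteq> bot"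
    "\<And>P. eventually P F \<longleftrightarrow> (\<exists>d\<in>D. \<forall>n\<in>D. le d n \<longrightarrow> P n)"
proof -
  define F where "F = (INF d\<in>D. principal {n\<in>D. le d n})"
  have ev: "eventually P F \<longleftrightarrow> (\<exists>d\<in>D. \<forall>n\<in>D. le d n \<longrightarrow> P n)" for P
  proof -
    have "eventually P F \<longleftrightarrow> (\<exists>d\<in>D. eventually P (principal {n\<in>D. le d n}))"
      unfolding F_def
    proof (rule eventually_INF_base)
      show "D \<noteq> {}" using assms by (simp add: directed_preorder_def)
    next
      fix a b assume ab: "a \<in> D" "b \<in> D"
      then obtain c where "c \<in> D" "le a c" "le b c"
        using assms unfolding directed_preorder_def by blast
      moreover have "{n\<in>D. le c n} \<subseteq> {n\<in>D. le a n} \<inter> {n\<in>D. le b n}"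
        using assms ab calculation unfolding directed_preorder_def by blast
      ultimately show "\<exists>x\<in>D. principal {n\<in>D. le x n}
          \<le> inf (principal {n\<in>D. le a n}) (principal {n\<in>D. le b n})"
        by (auto intro!: bexI[of _ c])
    qed
    then show ?thesis by (auto simp: eventually_principal)
  qed
  have "\<not> eventually (\<lambda>_. False) F"
    using assms unfolding ev directed_preorder_def by blast
  then have "F \<noteq> bot" by auto
  with ev show thesis by (rule that[rotated])
qed

lemma filter_net:
  fixes F :: "'n filter"
  assumes "F \<noteq> bot" and P: "eventually P F"
  obtains D :: "('n set \<times> 'n) set" and le where "directed_preorder D le"
    "\<And>d. d \<in> D \<Longrightarrow> P (snd d)"
    "\<And>Q. eventually Q F \<Longrightarrow> \<exists>d\<in>D. \<forall>n\<in>D. le d n \<longrightarrow> Q (snd n)"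
proof -
  define D where "D = {(A, n). n \<in> A \<and> eventually (\<lambda>m. m \<in> A) F \<and> (\<forall>m\<in>A. P m)}"
  define le where "le a b \<longleftrightarrow> fst b \<subseteq> fst a" for a b :: "'n set \<times> 'n"
  have ex: "\<exists>n. (A, n) \<in> D" if A: "eventually (\<lambda>m. m \<in> A) F" "\<forall>m\<in>A. P m" for A
  proof -
    obtain n where "n \<in> A" using eventually_happens'[OF assms(1) A(1)] by blast
    with A have "(A, n) \<in> D" unfolding D_def by blast
    then show ?thesis ..
  qed
  have "\<exists>n. ({m. P m}, n) \<in> D" using P by (intro ex) simp_all
  then have "D \<noteq> {}" by blast
  moreover have "\<exists>c\<in>D. le a c \<and> le b c" if "a \<in> D" "b \<in> D" for a b
  proof -
    have a: "eventually (\<lambda>m. m \<in> fst a) F" "\<forall>m\<in>fst a. P m"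
      and b: "eventually (\<lambda>m. m \<in> fst b) F"
      using that unfolding D_def by force+
    have "\<exists>n. (fst a \<inter> fst b, n) \<in> D"
      using a b by (intro ex) (simp_all add: eventually_conj)
    then obtain n where "(fst a \<inter> fst b, n) \<in> D" ..
    moreover have "le a (fst a \<inter> fst b, n)" "le b (fst a \<inter> fst b, n)"
      by (simp_all add: le_def)
    ultimately show ?thesis by blast
  qed
  ultimately have "directed_preorder D le"
    unfolding directed_preorder_def le_def by blast
  moreover have "P (snd d)" if "d \<in> D" for d using that by (auto simp: D_def)
  moreover have "\<exists>d\<in>D. \<forall>n\<in>D. le d n \<longrightarrow> Q (snd n)" if Q: "eventually Q F" for Q
  proof -
    have "\<exists>n. ({m. P m \<and> Q m}, n) \<in> D"
      using P Q by (intro ex) (simp_all add: eventually_conj)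
    then obtain n where "({m. P m \<and> Q m}, n) \<in> D" ..
    moreover have "\<forall>n'\<in>D. le ({m. P m \<and> Q m}, n) n' \<longrightarrow> Q (snd n')"
      by (auto simp: le_def D_def)
    ultimately show ?thesis by blast
  qed
  ultimately show thesis by (rule that)
qed

lemma proximal_if_net:
  assumes "directed_preorder D le"
    and "net_tendsto D le (\<lambda>n. act (t n) x) z" "net_tendsto D le (\<lambda>n. act (t n) y) z"
  shows "proximal act x y"
proof -
  obtain F where F: "F \<noteq> bot" "\<And>P. eventually P F \<longleftrightarrow> (\<exists>d\<in>D. \<forall>n\<in>D. le d n \<longrightarrow> P n)"
    by (rule net_filter[OF assms(1)]) blast
  have "((\<lambda>s. act s w) \<longlongrightarrow> z) (filtermap t F)"
    if "net_tendsto D le (\<lambda>n. act (t n) w) z" for w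
    using that unfolding tendsto_def eventually_filtermap F(2) net_tendsto_def by blast
  moreover have "filtermap t F \<noteq> bot" using F(1) by (simp add: filtermap_bot_iff)
  ultimately show ?thesis unfolding proximal_def using assms(2,3) by blast
qed

lemma proximal_iff_net:
  fixes act :: "'t \<Rightarrow> 'x::topological_space \<Rightarrow> 'x"
  shows "proximal act x y \<longleftrightarrow>
    (\<exists>(D::('t set \<times> 't) set) le t z. directed_preorder D le \<and>
      net_tendsto D le (\<lambda>n. act (t n) x) z \<and> net_tendsto D le (\<lambda>n. act (t n) y) z)"
    (is "?L \<longleftrightarrow> ?R")
proof
  assume ?L
  then obtain F z where F: "F \<noteq> bot" "((\<lambda>t. act t x) \<longlongrightarrow> z) F" "((\<lambda>t. act t y) \<longlongrightarrow> z) F"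
    unfolding proximal_def by blast
  obtain D :: "('t set \<times> 't) set" and le where D: "directed_preorder D le"
    "\<And>Q. eventually Q F \<Longrightarrow> \<exists>d\<in>D. \<forall>n\<in>D. le d n \<longrightarrow> Q (snd n)"
    by (rule filter_net[OF F(1) always_eventually[of "\<lambda>_. True"]]) auto
  have "net_tendsto D le (\<lambda>n. act (snd n) x) z" "net_tendsto D le (\<lambda>n. act (snd n) y) z"
    using F(2,3) D(2) unfolding net_tendsto_def tendsto_def by blast+
  with D(1) show ?R by blast
next
  assume ?R
  then obtain D :: "('t set \<times> 't) set" and le t z where "directed_preorder D le"
    "net_tendsto D le (\<lambda>n. act (t n) x) z" "net_tendsto D le (\<lambda>n. act (t n) y) z"
    by blast
  then show ?L by (rule proximal_if_net)
qed

lemma aa_point_net: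
  assumes "aa_point ract x" "directed_preorder D le"
    and "net_tendsto D le (\<lambda>n. ract x (t n)) y" "net_tendsto D le u x'"
    and "\<And>n. n \<in> D \<Longrightarrow> ract (u n) (t n) = y"
  shows "x = x'"
proof -
  obtain F where F: "F \<noteq> bot" "\<And>P. eventually P F \<longleftrightarrow> (\<exists>d\<in>D. \<forall>n\<in>D. le d n \<longrightarrow> P n)"
    by (rule net_filter[OF assms(2)]) blast
  obtain d where "d \<in> D" using assms(2) by (auto simp: directed_preorder_def)
  then have "\<forall>\<^sub>F n in F. ract (u n) (t n) = y"
    unfolding F(2) using assms(5) by blast
  moreover have "((\<lambda>n. ract x (t n)) \<longlongrightarrow> y) F" "(u \<longlongrightarrow> x') F"
    using assms(3,4) unfolding tendsto_def F(2) net_tendsto_def by blast+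
  ultimately show ?thesis
    using assms(1)[unfolded aa_point_def, rule_format,
        of "filtermap (\<lambda>n. (t n, u n)) F" y x'] F(1)
    by (simp add: filtermap_bot_iff filterlim_filtermap eventually_filtermap)
qed

lemma aa_point_iff_net:
  fixes ract :: "'x::topological_space \<Rightarrow> 't \<Rightarrow> 'x"
  shows "aa_point ract x \<longleftrightarrow>
    (\<forall>(D::(('t \<times> 'x) set \<times> 't \<times> 'x) set) le t u y x'. directed_preorder D le \<and>
      net_tendsto D le (\<lambda>n. ract x (t n)) y \<and> net_tendsto D le u x' \<and>
      (\<forall>n\<in>D. ract (u n) (t n) = y) \<longrightarrow> x = x')"
    (is "?L \<longleftrightarrow> ?R")
proof
  assume ?L
  show ?R
  proof (intro allI impI, elim conjE)
    fix D :: "(('t \<times> 'x) set \<times> 't \<times> 'x) set" and le t u y x'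
    assume "directed_preorder D le" "net_tendsto D le (\<lambda>n. ract x (t n)) y"
      "net_tendsto D le u x'" "\<forall>n\<in>D. ract (u n) (t n) = y"
    with \<open>?L\<close> show "x = x'" by (intro aa_point_net[of ract x D le t y u x']) auto
  qed
next
  assume R: ?R
  show ?L unfolding aa_point_def
  proof (intro allI impI, elim conjE)
    fix F :: "('t \<times> 'x) filter" and y x'
    assume F: "F \<noteq> bot" "((\<lambda>(t, u). ract x t) \<longlongrightarrow> y) F" "((\<lambda>(t, u). u) \<longlongrightarrow> x') F"
      and ev: "\<forall>\<^sub>F (t, u) in F. ract u t = y"
    obtain D :: "(('t \<times> 'x) set \<times> 't \<times> 'x) set" and le where D: "directed_preorder D le"
      "\<And>d. d \<in> D \<Longrightarrow> (case snd d of (t, u) \<Rightarrow> ract u t = y)"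
      "\<And>Q. eventually Q F \<Longrightarrow> \<exists>d\<in>D. \<forall>n\<in>D. le d n \<longrightarrow> Q (snd n)"
      by (rule filter_net[OF F(1) ev]) auto
    have "net_tendsto D le (\<lambda>n. ract x (fst (snd n))) y"
      "net_tendsto D le (\<lambda>n. snd (snd n)) x'"
      using F(2,3) D(3) unfolding net_tendsto_def tendsto_def case_prod_unfold by blast+
    moreover have "\<forall>n\<in>D. ract (snd (snd n)) (fst (snd n)) = y"
      using D(2) by (auto simp: case_prod_unfold)
    ultimately show "x = x'"
      using R[rule_format, of D le "\<lambda>n. fst (snd n)" y "\<lambda>n. snd (snd n)" x'] D(1) by simp
  qed
qed

end

theory Submission
  imports Defs
begin

text \<open>
  (a) The complement \<open>U\<close> of the closure of \<open>x\<^sub>0T\<close> satisfies \<open>tU \<subseteq> U\<close> for all \<open>t\<close>.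
  If \<open>U\<close> is nonempty, then \<open>X\<close> is covered by finitely many \<open>t\<^sub>i\<^sup>-\<^sup>1U\<close>, where by density the
  sets \<open>T - Tt\<^sub>i\<close> may be taken relatively compact.  Either some \<open>t\<close> lies in all \<open>Tt\<^sub>i\<close>, and then
  \<open>X = t\<^sup>-\<^sup>1U\<close>, or \<open>T\<close> is compact, and then all orbits are closed; in both cases \<open>U = X\<close>.

  (b) Let \<open>t\<^sub>n\<^sup>-\<^sup>1x\<^sub>0 = y\<^sub>n \<rightarrow> y\<close> and \<open>t\<^sub>ny \<rightarrow> x'\<close>.  By distality it is enough to move \<open>x\<^sub>0\<close> and
  \<open>x'\<close> simultaneously into any neighbourhood of \<open>x\<^sub>0\<close>.  Given \<open>AV \<subseteq> U\<close> as in local almost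
  periodicity, choose \<open>s\<close> with \<open>sy \<in> V\<close> and \<open>T - Ts\<close> relatively compact.  If the \<open>t\<^sub>n\<close>
  eventually stay outside \<open>Ts\<close>, they have a cluster point \<open>t\<close>, and \<open>x\<^sub>0 = ty = x'\<close>.
  Otherwise \<open>t\<^sub>n = r\<^sub>ns\<close> frequently, and \<open>k\<^sub>nr\<^sub>n \<in> A\<close> for some \<open>k\<^sub>n\<close> in a fixed compact set;
  then \<open>k\<^sub>nx\<^sub>0 = k\<^sub>nr\<^sub>nsy\<^sub>n\<close> and \<open>k\<^sub>nt\<^sub>ny\<close> both lie in \<open>U\<close>.
\<close>

section \<open>Filters and compactness\<close>

text \<open>The analogue of passing to a convergent subnet: \<open>G\<close> refines
  \<open>F\<close> by the preimages of the neighbourhoods of a cluster point of \<open>f\<close>.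
  Limits along \<open>F\<close> persist along \<open>G\<close>.\<close>

lemma compact_subfilter_tendsto:
  assumes "compact K" "F \<noteq> bot" "\<forall>\<^sub>F n in F. f n \<in> K"
  obtains G k where "G \<noteq> bot" "G \<le> F" "k \<in> K" "(f \<longlongrightarrow> k) G"
proof -
  have "filtermap f F \<noteq> bot" "\<forall>\<^sub>F x in filtermap f F. x \<in> K"
    using assms by (simp_all add: filtermap_bot_iff eventually_filtermap)
  then obtain k where k: "k \<in> K" "inf (nhds k) (filtermap f F) \<noteq> bot"
    using assms(1) unfolding compact_filter by blast
  define G where "G = inf F (filtercomap f (nhds k))"
  have "G \<noteq> bot"
  proof
    assume "G = bot"
    then have "eventually (\<lambda>_. False) G" by simp
    then obtain P Q where PQ: "eventually P F" "eventually Q (nhds k)"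
      "\<And>n. P n \<Longrightarrow> Q (f n) \<Longrightarrow> False"
      unfolding G_def eventually_inf eventually_filtercomap by metis
    have "eventually (\<lambda>x. \<not> Q x) (filtermap f F)"
      unfolding eventually_filtermap using PQ(1) by eventually_elim (use PQ(3) in blast)
    with PQ(2) have "eventually (\<lambda>_. False) (inf (nhds k) (filtermap f F))"
      unfolding eventually_inf by blast
    with k(2) show False by (simp add: trivial_limit_def)
  qed
  moreover have "(f \<longlongrightarrow> k) G"
    unfolding G_def by (simp add: filterlim_iff_le_filtercomap)
  ultimately show thesis using k(1) that G_def by simp
qed

text \<open>Serves to shrink a target neighbourhood, so that limits of points of \<open>W\<close>
  still lie in \<open>U\<close>.\<close>

lemma compact_t2_regular:
  fixes x :: "'x::t2_space"
  assumes "compact (UNIV :: 'x set)" "open U" "x \<in> U"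
  obtains W where "open W" "x \<in> W" "closure W \<subseteq> U"
proof -
  have "Hausdorff_space (euclidean :: 'x topology)"
    unfolding Hausdorff_space_def disjnt_def open_openin[symmetric] using hausdorff by metis
  then have "regular_space (euclidean :: 'x topology)"
    using assms(1) by (intro compact_Hausdorff_imp_regular_space) (simp_all add: compact_space_def)
  then have "neighbourhood_base_of (closedin euclidean) (euclidean :: 'x topology)"
    by (simp add: neighbourhood_base_of_closedin)
  then obtain W C where "open W" "closed C" "x \<in> W" "W \<subseteq> C" "C \<subseteq> U"
    using assms(2,3) unfolding neighbourhood_base_of open_openin[symmetric] closed_closedin[symmetric]
    by meson
  then show thesis
    using that[of W] closure_minimal[of W C] by (simp add: order_trans)
qed

section \<open>Basic properties of semiflows\<close>

lemma semiflow_tendsto: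
  assumes "semiflow act" "(f \<longlongrightarrow> t) F" "(g \<longlongrightarrow> x) F"
  shows "((\<lambda>n. act (f n) (g n)) \<longlongrightarrow> act t x) F"
proof -
  have "continuous_on UNIV (\<lambda>(t, x). act t x)"
    using assms(1) by (simp add: semiflow_def)
  from continuous_on_tendsto_compose[OF this tendsto_Pair[OF assms(2,3)]] show ?thesis by simp
qed

lemma semiflow_continuous:
  assumes "semiflow act"
  shows "continuous_on UNIV (act t)" "continuous_on UNIV (\<lambda>t. act t x)"
  by (auto simp: continuous_on_def intro!: semiflow_tendsto[OF assms] tendsto_intros)

lemma semiflow_act_act: "semiflow act \<Longrightarrow> act t (act s x) = act (t * s) x"
  by (simp add: semiflow_def)

lemma invertible_semiflow_act_inv:
  assumes "invertible_semiflow act"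
  shows "act t (inv (act t) x) = x" "inv (act t) (act t x) = x"
  using assms by (simp_all add: invertible_semiflow_def bij_is_surj surj_f_inv_f bij_is_inj)

text \<open>The times moving \<open>x\<close> into \<open>U\<close> form an open set, nonempty by
  minimality, so it meets the dense set given by the almost right C property.\<close>

lemma minimal_semiflow_hits_open:
  fixes act :: "'t::topological_monoid_mult \<Rightarrow> 'x::topological_space \<Rightarrow> 'x"
  assumes "semiflow act" "minimal_semiflow act" "almost_right_C_semigroup TYPE('t)"
    and "open U" "U \<noteq> {}"
  obtains t where "act t x \<in> U" "compact (closure (UNIV - range (\<lambda>s. s * t)))"
proof -
  have "closure (range (\<lambda>t. act t x)) \<inter> U \<noteq> {}"
    using assms(2,5) by (simp add: minimal_semiflow_def)
  then have "(\<lambda>t. act t x) -` U \<noteq> {}"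
    using open_Int_closure_eq_empty[OF assms(4)] by blast
  moreover have "open ((\<lambda>t. act t x) -` U)"
    using open_vimage[OF assms(4) semiflow_continuous(2)[OF assms(1)]] .
  ultimately have "(\<lambda>t. act t x) -` U \<inter> {t. compact (closure (UNIV - range (\<lambda>s. s * t)))} \<noteq> {}"
    using assms(3) open_Int_closure_eq_empty unfolding almost_right_C_semigroup_def
    by (metis inf_top.right_neutral)
  then show thesis using that by blast
qed

section \<open>Minimality of the reflection\<close>

lemma forward_invariant_open_eq_UNIV:
  fixes act :: "'t::topological_monoid_mult \<Rightarrow> 'x::t2_space \<Rightarrow> 'x"
  assumes "compact (UNIV :: 'x set)" "semiflow act" "invertible_semiflow act"
    and "minimal_semiflow act" "almost_right_C_semigroup TYPE('t)"
    and U: "open U" "U \<noteq> {}" "\<And>t u. u \<in> U \<Longrightarrow> act t u \<in> U"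
  shows "U = UNIV"
proof -
  define C where "C = {t::'t. compact (closure (UNIV - range (\<lambda>s. s * t)))}"
  have "UNIV \<subseteq> (\<Union>t\<in>C. act t -` U)"
  proof
    fix x
    obtain t where "act t x \<in> U" "t \<in> C"
      unfolding C_def by (rule minimal_semiflow_hits_open[OF assms(2,4,5) U(1,2), of x]) simp
    then show "x \<in> (\<Union>t\<in>C. act t -` U)" by blast
  qed
  then obtain D where D: "D \<subseteq> C" "finite D" "UNIV \<subseteq> (\<Union>t\<in>D. act t -` U)"
    by (rule compactE_image[OF assms(1) open_vimage[OF U(1) semiflow_continuous(1)[OF assms(2)]]])
  show ?thesis
  proof (cases "\<exists>t. \<forall>d\<in>D. t \<in> range (\<lambda>s. s * d)")
    case True
    then obtain t where t: "\<forall>d\<in>D. \<exists>s. t = s * d" by blast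
    \<comment> \<open>Since t = sd with dx in U, invariance under s gives tx in U. Surjectivity of
      \<open>act t\<close> then yields U = X.\<close>
    have "act t x \<in> U" for x
    proof -
      obtain d where "d \<in> D" "act d x \<in> U" using D(3) by blast
      with t U(3) show ?thesis by (metis semiflow_act_act[OF assms(2)])
    qed
    then show ?thesis by (metis UNIV_eq_I invertible_semiflow_act_inv(1)[OF assms(3)])
  next
    case False
    \<comment> \<open>Every t misses some Td, so T is a finite union of compact closures.\<close>
    then have "(\<Union>d\<in>D. UNIV - range (\<lambda>s. s * d)) = UNIV"
      by blast
    then have "(\<Union>d\<in>D. closure (UNIV - range (\<lambda>s. s * d))) = UNIV"
      using UN_mono[OF order_refl closure_subset] by (metis top.extremum_unique)
    moreover have "compact (\<Union>d\<in>D. closure (UNIV - range (\<lambda>s. s * d)))"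
      using D(1,2) by (intro compact_UN) (auto simp: C_def)
    ultimately have "compact (UNIV :: 't set)" by simp
    then have "closed (range (\<lambda>t. act t x))" for x
      using compact_continuous_image[OF semiflow_continuous(2)[OF assms(2)]]
      by (intro compact_imp_closed) blast
    then have orbit: "range (\<lambda>t. act t x) = UNIV" for x
      using assms(4) by (simp add: minimal_semiflow_def)
    obtain u where "u \<in> U" using U(2) by blast
    then have "range (\<lambda>t. act t u) \<subseteq> U" using U(3) by blast
    then show ?thesis unfolding orbit by (rule top.extremum_uniqueI)
  qed
qed

lemma minimal_reflection:
  fixes act :: "'t::topological_monoid_mult \<Rightarrow> 'x::t2_space \<Rightarrow> 'x"
  assumes "compact (UNIV :: 'x set)" "semiflow act" "invertible_semiflow act"
    and "minimal_semiflow act" "almost_right_C_semigroup TYPE('t)"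
  shows "minimal_right_semiflow (reflection act)"
  unfolding minimal_right_semiflow_def
proof
  fix x
  define R where "R = range (\<lambda>t. reflection act x t)"
  note inv = invertible_semiflow_act_inv[OF assms(3)]
  \<comment> \<open>Inverse transitions compose contravariantly: applying the inverse of s and then
    that of t inverts st.\<close>
  have "inv (act t) ` R \<subseteq> R" for t
  proof
    fix z assume "z \<in> inv (act t) ` R"
    then obtain s where "z = inv (act t) (inv (act s) x)"
      by (auto simp: R_def reflection_def)
    then have "act (s * t) z = x"
      by (simp add: inv flip: semiflow_act_act[OF assms(2)])
    then have "z = reflection act x (s * t)"
      unfolding reflection_def by (metis inv(2))
    then show "z \<in> R" by (simp add: R_def)
  qed
  \<comment> \<open>A continuous bijection of a compact Hausdorff space is a homeomorphism.\<close>
  moreover have "continuous_on UNIV (inv (act t))" for t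
    using continuous_on_inv[OF semiflow_continuous(1)[OF assms(2)] assms(1), of "inv (act t)" t]
      assms(3) by (simp add: inv invertible_semiflow_def bij_is_surj)
  ultimately have R: "inv (act t) ` closure R \<subseteq> closure R" for t
    by (meson closed_closure closure_subset continuous_on_subset image_closure_subset
        order_trans subset_UNIV)
  have "act t u \<in> - closure R" if "u \<in> - closure R" for t u
  proof
    assume "act t u \<in> closure R"
    then have "inv (act t) (act t u) \<in> closure R" using R by blast
    with that show False by (simp add: inv(2))
  qed
  note U_eq = forward_invariant_open_eq_UNIV[OF assms open_Compl[OF closed_closure] _ this]
  have "reflection act x 1 \<in> closure R"
    using closure_subset by (force simp: R_def)
  then have "- closure R = {}" using U_eq by blast
  then show "closure (range (\<lambda>t. reflection act x t)) = UNIV"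
    by (auto simp: R_def)
qed

section \<open>Distal l.a.p. points are a.a. points\<close>

text \<open>The required filter on T is pulled back from the neighbourhoods of
  \<open>(z, z)\<close>; the hypothesis makes it proper.\<close>

lemma proximalI:
  assumes "\<And>U. open U \<Longrightarrow> z \<in> U \<Longrightarrow> \<exists>t. act t x \<in> U \<and> act t y \<in> U"
  shows "proximal act x y"
proof -
  define F where "F = filtercomap (\<lambda>t. (act t x, act t y)) (nhds z \<times>\<^sub>F nhds z)"
  have "F \<noteq> bot"
    unfolding F_def
  proof (rule filtercomap_neq_bot)
    fix P assume "eventually P (nhds z \<times>\<^sub>F nhds z)"
    then obtain U where "open U" "z \<in> U" "\<And>a b. a \<in> U \<Longrightarrow> b \<in> U \<Longrightarrow> P (a, b)"
      unfolding eventually_prod_same eventually_nhds by metis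
    with assms[of U] show "\<exists>t. P (act t x, act t y)" by blast
  qed
  moreover have lim: "filterlim (\<lambda>t. (act t x, act t y)) (nhds z \<times>\<^sub>F nhds z) F"
    unfolding F_def by (rule filterlim_filtercomap)
  then have "((\<lambda>t. act t x) \<longlongrightarrow> z) F" "((\<lambda>t. act t y) \<longlongrightarrow> z) F"
    using filterlim_compose[OF filterlim_fst lim] filterlim_compose[OF filterlim_snd lim]
    by simp_all
  ultimately show ?thesis unfolding proximal_def by blast
qed

lemma lap_limit_proximal:
  fixes act :: "'t::topological_monoid_mult \<Rightarrow> 'x::t2_space \<Rightarrow> 'x"
  assumes "compact (UNIV :: 'x set)" "semiflow act"
    and "minimal_semiflow act" "almost_right_C_semigroup TYPE('t)"
    and lap: "locally_almost_periodic act x\<^sub>0"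
    and F: "F \<noteq> bot" "(v \<longlongrightarrow> y) F" "\<And>n. act (t n) (v n) = x\<^sub>0"
      "((\<lambda>n. act (t n) y) \<longlongrightarrow> x') F"
  shows "proximal act x\<^sub>0 x'"
proof (rule proximalI[of x\<^sub>0])
  fix U :: "'x set" assume "open U" "x\<^sub>0 \<in> U"
  then obtain W where W: "open W" "x\<^sub>0 \<in> W" "closure W \<subseteq> U"
    by (rule compact_t2_regular[OF assms(1)])
  have "\<exists>V A. open V \<and> x\<^sub>0 \<in> V \<and> syndetic A \<and> (\<forall>a\<in>A. act a ` V \<subseteq> W)"
    using lap W(1,2) unfolding locally_almost_periodic_def by simp
  then obtain V A where V: "open V" "x\<^sub>0 \<in> V" "\<And>a u. a \<in> A \<Longrightarrow> u \<in> V \<Longrightarrow> act a u \<in> W"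
    and "syndetic A"
    by blast
  then obtain K where K: "compact K" and "\<And>r. (\<lambda>k. k * r) ` K \<inter> A \<noteq> {}"
    unfolding syndetic_def by (elim exE conjE) simp
  then have KA: "\<exists>k\<in>K. k * r \<in> A" for r by blast
  obtain s where s: "act s y \<in> V" "compact (closure (UNIV - range (\<lambda>r. r * s)))"
    by (rule minimal_semiflow_hits_open[OF assms(2-4) V(1), of y]) (use V(2) in auto)
  show "\<exists>k. act k x\<^sub>0 \<in> U \<and> act k x' \<in> U"
  proof (cases "\<exists>\<^sub>F n in F. t n \<in> range (\<lambda>r. r * s)")
    \<comment> \<open>The cluster point \<open>t'\<close> satisfies
      \<open>act t' y = x\<^sub>0 = x'\<close>, so the identity is a witness.\<close>
    case False
    then have "\<forall>\<^sub>F n in F. t n \<in> closure (UNIV - range (\<lambda>r. r * s))"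
      unfolding not_frequently by eventually_elim (use closure_subset in blast)
    then obtain G t' where G: "G \<noteq> bot" "G \<le> F" "(t \<longlongrightarrow> t') G"
      by (rule compact_subfilter_tendsto[OF s(2) F(1)])
    have "((\<lambda>n. act (t n) (v n)) \<longlongrightarrow> act t' y) G"
      using semiflow_tendsto[OF assms(2) G(3) tendsto_mono[OF G(2) F(2)]] .
    then have "act t' y = x\<^sub>0"
      using G(1) by (simp add: F(3) tendsto_const_iff)
    moreover have "x' = act t' y"
      using tendsto_unique[OF G(1) tendsto_mono[OF G(2) F(4)]
          semiflow_tendsto[OF assms(2) G(3) tendsto_const]] .
    moreover have "act 1 x\<^sub>0 = x\<^sub>0"
      using assms(2) by (simp add: semiflow_def)
    ultimately show ?thesis
      using \<open>x\<^sub>0 \<in> U\<close> by metis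
  next
    case True
    define H where "H = inf F (principal {n. t n \<in> range (\<lambda>r. r * s)})"
    have H: "H \<noteq> bot" "H \<le> F"
      using True by (auto simp: H_def trivial_limit_def eventually_inf_principal frequently_def)
    have ev: "\<forall>\<^sub>F n in H. t n \<in> range (\<lambda>r. r * s)"
      by (simp add: H_def eventually_inf_principal)
    \<comment> \<open>\<open>inv\<close> chooses some right quotient of \<open>t n\<close> by
      \<open>s\<close>, meaningful only when \<open>t n\<close> lies in Ts, which holds eventually
      along \<open>H\<close>. The property of \<open>k\<close> below holds for every value of
      \<open>r n\<close>.\<close>
    define r where "r n = inv (\<lambda>r. r * s) (t n)" for n
    obtain \<kappa> where \<kappa>: "\<forall>q. \<kappa> q \<in> K \<and> \<kappa> q * q \<in> A"
      using KA by metis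
    define k where "k n = \<kappa> (r n)" for n
    have k: "k n \<in> K" "k n * r n \<in> A" for n
      using \<kappa> by (simp_all add: k_def)
    \<comment> \<open>As \<open>x'\<close> is only the limit of \<open>act (t n) y\<close>, the
      multipliers must converge too; joint continuity then makes the single element
      \<open>k'\<close> serve both points.\<close>
    obtain G k' where G: "G \<noteq> bot" "G \<le> H" "(k \<longlongrightarrow> k') G"
      by (rule compact_subfilter_tendsto[OF K H(1), of k]) (simp add: k(1))
    have GF: "G \<le> F" using G(2) H(2) by simp
    have in_W: "act (k n) (act (t n) u) \<in> W"
      if "t n \<in> range (\<lambda>r. r * s)" "act s u \<in> V" for n u
    proof -
      have "t n = r n * s" using f_inv_into_f[OF that(1)] by (simp add: r_def)
      then have "act (k n) (act (t n) u) = act (k n * r n) (act s u)"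
        by (simp add: semiflow_act_act[OF assms(2)] mult.assoc)
      then show ?thesis using V(3)[OF k(2) that(2)] by simp
    qed
    have "((\<lambda>n. act s (v n)) \<longlongrightarrow> act s y) G"
      using semiflow_tendsto[OF assms(2) tendsto_const tendsto_mono[OF GF F(2)]] .
    then have "\<forall>\<^sub>F n in G. act s (v n) \<in> V"
      using V(1) s(1) by (rule topological_tendstoD)
    then have "\<forall>\<^sub>F n in G. act (k n) x\<^sub>0 \<in> closure W"
      using filter_leD[OF G(2) ev]
      by eventually_elim (use in_W F(3) in \<open>force intro: closure_subset[THEN subsetD]\<close>)
    then have "act k' x\<^sub>0 \<in> closure W"
      using Lim_in_closed_set[OF closed_closure _ G(1) semiflow_tendsto[OF assms(2) G(3) tendsto_const]]
      by simp
    moreover have "\<forall>\<^sub>F n in G. act (k n) (act (t n) y) \<in> closure W"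
      using filter_leD[OF G(2) ev]
      by eventually_elim (intro closure_subset[THEN subsetD] in_W s(1))
    then have "act k' x' \<in> closure W"
      using Lim_in_closed_set[OF closed_closure _ G(1)
          semiflow_tendsto[OF assms(2) G(3) tendsto_mono[OF GF F(4)]]]
      by simp
    ultimately show ?thesis using W(3) by blast
  qed
qed

theorem theorem0p17:
  fixes act :: "'t::topological_monoid_mult \<Rightarrow> 'x::t2_space \<Rightarrow> 'x"
    and x\<^sub>0 :: 'x
  assumes "compact (UNIV :: 'x set)"
    and "semiflow act"
    and "invertible_semiflow act"
    and "minimal_semiflow act"
    and "almost_right_C_semigroup TYPE('t)"
  shows "minimal_right_semiflow (reflection act) \<and>
    (distal_point act x\<^sub>0 \<and> locally_almost_periodic act x\<^sub>0 \<longrightarrow>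
      aa_point (reflection act) x\<^sub>0)"
proof (intro conjI impI)
  show "minimal_right_semiflow (reflection act)"
    using minimal_reflection[OF assms] .
next
  assume x0: "distal_point act x\<^sub>0 \<and> locally_almost_periodic act x\<^sub>0"
  note inv = invertible_semiflow_act_inv[OF assms(3)]
  show "aa_point (reflection act) x\<^sub>0"
    unfolding aa_point_def
  proof (intro allI impI, elim conjE)
    fix F :: "('t \<times> 'x) filter" and y x'
    assume F: "F \<noteq> bot" "((\<lambda>(t, u). reflection act x\<^sub>0 t) \<longlongrightarrow> y) F"
      "((\<lambda>(t, u). u) \<longlongrightarrow> x') F" "\<forall>\<^sub>F (t, u) in F. reflection act u t = y"
    \<comment> \<open>The equation for the reflection determines the second net as the images of
      \<open>y\<close>, whose limit is therefore \<open>x'\<close>.\<close>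
    have "\<forall>\<^sub>F n in F. (case n of (t, u) \<Rightarrow> u) = act (fst n) y"
      using F(4) by eventually_elim (auto simp: reflection_def inv)
    then have "((\<lambda>n. act (fst n) y) \<longlongrightarrow> x') F"
      by (rule Lim_transform_eventually[OF F(3)])
    moreover have "((\<lambda>n. inv (act (fst n)) x\<^sub>0) \<longlongrightarrow> y) F"
      using F(2) by (simp add: reflection_def case_prod_unfold)
    ultimately have "proximal act x\<^sub>0 x'"
      using lap_limit_proximal[OF assms(1,2,4,5) conjunct2[OF x0] F(1),
          of "\<lambda>n. inv (act (fst n)) x\<^sub>0" y fst] by (simp add: inv)
    moreover have "x' \<in> closure (range (\<lambda>t. act t x\<^sub>0))"
      using assms(4) by (simp add: minimal_semiflow_def)
    ultimately show "x\<^sub>0 = x'"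
      using x0 unfolding distal_point_def by blast
  qed
qed

end
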